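(* There exists an online algorithm $\mathrm{ALG}$ for OSCC (specified for every $n$) such that $\limsup_{n\to\infty}R_n^C(\mathrm{ALG})\le 4.179$, where $R_n^C(\mathrm{ALG})=\sup_{F\in\mathcal F}\mathtt{ALG}_n(F)/\mathtt{OPT}_n(F)$.
   Context: Let $\mathcal F$ be the family of CDFs of nonnegative random variables with finite mean. In the concurrent-contracts model (OSCC), an instance is $F\in\mathcal F$ and an integer $n\ge1$; $X_1,\dots,X_n$ are i.i.d. with CDF $F$, revealed one at a time. At time $i$, knowing $F,n$, $X_1,\dots,X_i$ and past decisions, an online algorithm chooses an integer $T_i\ge0$; this contract covers times $i,\dots,i+T_i-1$ (contracts may overlap) at cost $T_iX_i$, and if time $i$ is covered by no earlier contract it must choose $T_i\ge1$. $\mathtt{ALG}_n(F)=\mathbb E[\sum_{i=1}^nT_iX_i]$, $\mathtt{OPT}_n(F)=\mathbb E[\sum_{i=1}^n\min\{X_1,\dots,X_i\}]$. *)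

theory Defs
  imports "HOL-Probability.Probability"
begin

definition distF :: "real measure \<Rightarrow> bool" where
  "distF M \<longleftrightarrow> prob_space M \<and> sets M = sets borel \<and> (AE x in M. 0 \<le> x)
      \<and> integrable M (\<lambda>x. x)"

definition sample :: "real measure \<Rightarrow> nat \<Rightarrow> (nat \<Rightarrow> real) measure" where
  "sample M n = PiM {..<n} (\<lambda>_. M)"

text \<open>A (deterministic) online policy: given F, n and the observed prefix
  [X_0, ..., X_i] it returns the contract length T_i.  Past decisions are
  functions of the same data, so they need not be passed explicitly.\<close>
type_synonym policy = "real measure \<Rightarrow> nat \<Rightarrow> real list \<Rightarrow> nat"

definition T :: "policy \<Rightarrow> real measure \<Rightarrow> nat \<Rightarrow> (nat \<Rightarrow> real) \<Rightarrow> nat \<Rightarrow> nat" where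
  "T A M n x i = A M n (map x [0..<Suc i])"

text \<open>Valid online algorithm: measurable decisions and every time 0..n-1 covered by
  some contract started at or before it (contract at j covers j..j+T_j-1).\<close>
definition valid_alg :: "policy \<Rightarrow> bool" where
  "valid_alg A \<longleftrightarrow> (\<forall>M n. distF M \<longrightarrow>
      (\<forall>i<n. (\<lambda>x. T A M n x i) \<in> measurable (sample M n) (count_space UNIV)) \<and>
      (\<forall>x. (\<forall>i<n. 0 \<le> x i) \<longrightarrow> (\<forall>i<n. \<exists>j\<le>i. i < j + T A M n x j)))"

definition ALG :: "policy \<Rightarrow> real measure \<Rightarrow> nat \<Rightarrow> ennreal" where
  "ALG A M n = (\<integral>\<^sup>+ x. ennreal (\<Sum>i<n. real (T A M n x i) * x i) \<partial>sample M n)"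

definition OPT :: "real measure \<Rightarrow> nat \<Rightarrow> ennreal" where
  "OPT M n = (\<integral>\<^sup>+ x. ennreal (\<Sum>i<n. Min (x ` {..i})) \<partial>sample M n)"

text \<open>Competitive ratio R_n^C (ennreal division; degenerate F = 0 a.s. gives 0/0 = 0).\<close>
definition RC :: "policy \<Rightarrow> nat \<Rightarrow> ennreal" where
  "RC A n = (SUP M\<in>{M. distF M}. ALG A M n / OPT M n)"

end

(* The conditions on a rule that depends only on quantiles decouple over the levels of the cost: it
suffices to compare, for every quantile v, the expected hired time N(v) of items above v with
OPT's value, sum of (1-v)^i over i = 1, ..., n.  An item of quantile u is hired for about (8/3)/u
steps, provided this is more than twice the time that is still covered.  Every state r >= 1 is then visited
at most once in expectation (and r = 0 at most twice), so that N(v) <= (32/9) (1/v - 1); moreover all hired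
contracts, cut at n, have total length at most (11/7) n.  The first bound is used for v >= 2/n,
where OPT's value is at least (1 - exp(-2)) (1/v - 1), the second for smaller v.  Both follow from
supersolutions of the Bellman equation; the actual algorithm minimises, deterministically, the cost
of a contract plus the potential of the resulting state. *)
theory Submission
  imports Defs
begin

section \<open>The quantile rule on a uniform quantile\<close>

abbreviation unif :: "real measure" where
  "unif \<equiv> density lborel (indicator {0<..<1})"

lemma nn_integral_unif:
  "f \<in> borel_measurable borel \<Longrightarrow> (\<integral>\<^sup>+u. f u \<partial>unif) = (\<integral>\<^sup>+u. f u * indicator {0<..<1} u \<partial>lborel)"
  by (simp add: nn_integral_density mult.commute)

text \<open>\<open>u\<close> is the quantile of the current value. \<open>dur u\<close> is a discretisation of \<open>(8/3)/u\<close>, shifted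
  so that \<open>dur u \<ge> 1\<close> on \<open>(0,1)\<close>, and \<open>lev k\<close> is the probability that \<open>dur u \<ge> k\<close>. In a state
  with \<open>r\<close> time steps still covered and \<open>m\<close> steps to go, \<open>hire r m u\<close> is the contract length of
  the quantile rule, \<open>0\<close> meaning that the value is skipped.\<close>

definition lev :: "nat \<Rightarrow> real" where
  "lev k = 8 / (3 * real k + 5)"

definition dur :: "real \<Rightarrow> nat" where
  "dur u = nat \<lfloor>(8 / u - 5) / 3\<rfloor>"

definition hire :: "nat \<Rightarrow> nat \<Rightarrow> real \<Rightarrow> nat" where
  "hire r m u = (if 2 * r + 1 \<le> dur u then min (dur u) m else 0)"

text \<open>\<open>visits j r\<close> dominates the expected number of future steps at which exactly \<open>j\<close> steps are
  covered, starting from \<open>r\<close>. The constant \<open>8/3\<close> and the acceptance threshold \<open>2 * r + 1\<close> make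
  the hyperbola beyond \<open>j\<close> superharmonic.\<close>

definition visits :: "nat \<Rightarrow> nat \<Rightarrow> real" where
  "visits j r = (if r < j then 1 else 2 * (3 * real j + 5) / (3 * real r + 5))"

lemma lev_pos: "0 < lev k"
  by (simp add: lev_def add_pos_nonneg)

lemma lev_1: "lev (Suc 0) = 1"
  by (simp add: lev_def)

lemma lev_antimono: "j \<le> k \<Longrightarrow> lev k \<le> lev j"
  unfolding lev_def by (intro divide_left_mono mult_pos_pos) (auto simp: add_pos_nonneg add_nonneg_pos)

lemma lev_le_1: "1 \<le> k \<Longrightarrow> lev k \<le> 1"
  using lev_antimono[of 1 k] lev_1 by simp

lemma visits_nonneg: "0 \<le> visits j r"
  by (simp add: visits_def)

lemma measurable_dur [measurable]: "dur \<in> measurable borel (count_space UNIV)"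
  unfolding dur_def by measurable

lemma measurable_hire [measurable]: "hire r m \<in> measurable borel (count_space UNIV)"
  unfolding hire_def by measurable

lemma le_dur_iff:
  assumes "0 < u" "1 \<le> k"
  shows "k \<le> dur u \<longleftrightarrow> u \<le> lev k"
proof -
  have "k \<le> dur u \<longleftrightarrow> int k \<le> \<lfloor>(8 / u - 5) / 3\<rfloor>"
    unfolding dur_def using assms(2) by linarith
  also have "\<dots> \<longleftrightarrow> real k \<le> (8 / u - 5) / 3"
    by (simp add: le_floor_iff)
  also have "\<dots> \<longleftrightarrow> u \<le> lev k"
    using assms by (simp add: lev_def field_simps)
  finally show ?thesis .
qed

lemma dur_ge_1: "0 < u \<Longrightarrow> u \<le> 1 \<Longrightarrow> 1 \<le> dur u"
  by (simp add: le_dur_iff lev_1)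

text \<open>The values of \<open>hire r m u\<close> belong to consecutive intervals of quantiles: a
  skip to \<open>u\<close> above \<open>lev (2*r+1)\<close>, length \<open>k\<close> to
  \<open>u\<close> between \<open>lev (Suc k)\<close> and \<open>lev k\<close>, the cut length
  \<open>m\<close> to all smaller \<open>u\<close>.\<close>

lemma nn_integral_hire_le:
  fixes H :: "nat \<Rightarrow> ennreal"
  shows "(\<integral>\<^sup>+u. H (hire r m u) \<partial>unif)
    \<le> ennreal (1 - lev (2*r+1)) * H 0
      + (\<Sum>k=2*r+1..<m. ennreal (lev k - lev (Suc k)) * H k)
      + ennreal (lev (max (2*r+1) m)) * H m"
proof -
  let ?g = "2*r+1"
  \<comment> \<open>The \<open>max\<close> in the last interval handles \<open>m < ?g\<close>: every
    accepted value is then cut to length \<open>m\<close>.\<close>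
  let ?h = "\<lambda>u. H 0 * indicator {lev ?g<..1} u
      + (\<Sum>k=?g..<m. H k * indicator {lev (Suc k)<..lev k} u)
      + H m * indicator {0<..lev (max ?g m)} u"
  have pt: "H (hire r m u) \<le> ?h u" if u: "0 < u" "u < 1" for u
  proof (cases "?g \<le> dur u")
    case False
    then have "\<not> u \<le> lev ?g" using le_dur_iff[of u ?g] u by simp
    then show ?thesis using False u by (simp add: hire_def add_increasing2)
  next
    case g: True
    show ?thesis
    proof (cases "m \<le> dur u")
      case True
      then have "u \<le> lev (max ?g m)"
        using g u le_dur_iff[of u "max ?g m"] by simp
      then show ?thesis using True g u by (simp add: hire_def add_increasing)
    next
      case False
      let ?d = "dur u"
      have "u \<le> lev ?d" using le_dur_iff[of u ?d] u g by simp
      moreover have "\<not> u \<le> lev (Suc ?d)" using le_dur_iff[of u "Suc ?d"] u by simp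
      ultimately have "H ?d = H ?d * indicator {lev (Suc ?d)<..lev ?d} u" by simp
      also have "\<dots> \<le> (\<Sum>k=?g..<m. H k * indicator {lev (Suc k)<..lev k} u)"
        using False g by (intro member_le_sum) auto
      finally show ?thesis using False g by (simp add: hire_def add_increasing add_increasing2)
    qed
  qed
  have "(\<integral>\<^sup>+u. H (hire r m u) \<partial>unif) = (\<integral>\<^sup>+u. H (hire r m u) * indicator {0<..<1} u \<partial>lborel)"
    by (intro nn_integral_unif) measurable
  also have "\<dots> \<le> (\<integral>\<^sup>+u. ?h u \<partial>lborel)"
  proof (intro nn_integral_mono)
    fix u :: real
    show "H (hire r m u) * indicator {0<..<1} u \<le> ?h u"
    proof (cases "0 < u \<and> u < 1")
      case True
      then show ?thesis using pt[of u] by (simp del: sum_mult_indicator)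
    qed (auto simp: indicator_def)
  qed
  also have "\<dots> = H 0 * emeasure lborel {lev ?g<..1}
      + (\<Sum>k=?g..<m. H k * emeasure lborel {lev (Suc k)<..lev k})
      + H m * emeasure lborel {0<..lev (max ?g m)}"
    by (simp add: nn_integral_add nn_integral_sum nn_integral_cmult_indicator del: sum_mult_indicator)
  also have "\<dots> = ennreal (1 - lev (2*r+1)) * H 0
      + (\<Sum>k=2*r+1..<m. ennreal (lev k - lev (Suc k)) * H k)
      + ennreal (lev (max (2*r+1) m)) * H m"
    using lev_le_1[of ?g] lev_pos less_imp_le[OF lev_pos]
    by (simp add: lev_antimono mult.commute)
  finally show ?thesis .
qed

section \<open>Supersolutions of the Bellman equation\<close>

text \<open>The sum telescopes: \<open>B k\<close> is the closed form of the same series summed from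
  \<open>k\<close> to infinity.\<close>

lemma visits_weighted_sum_le:
  assumes "1 \<le> g"
  shows "(\<Sum>k=g..<m. (lev k - lev (Suc k)) * visits j (k - 1))
     \<le> (if g \<le> j then lev g else lev g * (3 * real j + 5) / (3 * real g + 2))"
proof -
  define B where "B k = (if k \<le> j then lev k else lev k * (3 * real j + 5) / (3 * real k + 2))" for k
  have step: "(lev k - lev (Suc k)) * visits j (k - 1) = B k - B (Suc k)" if k1: "1 \<le> k" for k
  proof -
    obtain i where k: "k = Suc i" using k1 by (cases k) auto
    consider "k < j" | "k = j" | "j < k" by linarith
    then show ?thesis
    proof cases
      case 1
      then show ?thesis using k by (simp add: visits_def B_def)
    next
      case 2
      \<comment> \<open>The two formulas for \<open>B\<close> agree at \<open>Suc j\<close>, so the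
        telescoping survives the change of branch.\<close>
      then have "(3 * real j + 5) / (3 * real (Suc k) + 2) = 1" by (simp add: field_simps)
      moreover have "B (Suc k) = lev (Suc k) * ((3 * real j + 5) / (3 * real (Suc k) + 2))" using 2 by (simp add: B_def)
      ultimately have "B (Suc k) = lev (Suc k)" by (simp only: mult_1_right)
      then show ?thesis using 2 k by (simp add: visits_def B_def)
    next
      case 3
      then have "j \<le> i" "\<not> i < j" using k by auto
      then have v: "visits j (k - 1) = 2 * (3 * real j + 5) / (3 * real i + 5)"
        by (simp add: visits_def k)
      define x where "x = 3 * real i"
      define y where "y = 3 * real j + 5"
      have x: "0 \<le> x" by (simp add: x_def)
      have l: "lev k = 8 / (x + 8)" "lev (Suc k) = 8 / (x + 11)" by (simp_all add: lev_def k x_def algebra_simps)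
      have b: "B k = 8 / (x+8) * y / (x + 5)" "B (Suc k) = 8 / (x+11) * y / (x+8)"
        using 3 l by (simp_all add: B_def y_def k x_def algebra_simps)
      show ?thesis unfolding v l b x_def[symmetric] y_def[symmetric]
        using x by (simp add: divide_simps add_nonneg_eq_0_iff) algebra
    qed
  qed
  have "(\<Sum>k=g..<m. (lev k - lev (Suc k)) * visits j (k - 1)) = (\<Sum>k=g..<m. B k - B (Suc k))"
    by (intro sum.cong refl step) (use assms in auto)
  also have "\<dots> \<le> B g"
  proof (cases "g \<le> m")
    case True
    have "0 \<le> B m" "0 \<le> B g" using less_imp_le[OF lev_pos] by (simp_all add: B_def)
    then show ?thesis using sum_Suc_diff'[of g m "\<lambda>k. - B k"] True by simp
  next
    case False
    have "0 \<le> B g" using less_imp_le[OF lev_pos] by (simp add: B_def)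
    then show ?thesis using False by simp
  qed
  finally show ?thesis by (simp add: B_def)
qed

text \<open>Bellman inequality for counting visits to state \<open>j\<close>. A skip, of probability
  \<open>1 - lev (2*r+1)\<close>, leads from \<open>r\<close> to \<open>r - 1\<close>, a contract of
  length \<open>k\<close> leads to \<open>k - 1\<close>, and one that reaches the horizon ends the
  count. For \<open>r \<le> j\<close> the future contributes at most 1, and the current visit is
  paid by the jump of \<open>visits\<close> to 2 at \<open>j\<close>. Beyond \<open>j\<close> both
  sides scale with \<open>3 * real j + 5\<close>, and a rational inequality in \<open>r\<close>
  remains.\<close>

lemma visits_supersolution:
  shows "of_bool (r = j) + (1 - lev (2*r+1)) * visits j (r - 1)
      + (\<Sum>k=2*r+1..<m. (lev k - lev (Suc k)) * visits j (k - 1)) \<le> visits j r"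
proof -
  let ?g = "2*r+1"
  let ?S = "\<Sum>k=?g..<m. (lev k - lev (Suc k)) * visits j (k - 1)"
  have S: "?S \<le> (if ?g \<le> j then lev ?g else lev ?g * (3 * real j + 5) / (3 * real ?g + 2))"
    by (rule visits_weighted_sum_le) simp
  show ?thesis
  proof (cases "r \<le> j")
    case True
    have "?S \<le> lev ?g"
    proof (cases "?g \<le> j")
      case False
      then have "(3 * real j + 5) / (3 * real ?g + 2) \<le> 1" by simp
      then have "lev ?g * ((3 * real j + 5) / (3 * real ?g + 2)) \<le> lev ?g"
        by (intro mult_left_le) (auto simp: less_imp_le[OF lev_pos])
      then show ?thesis using S False by simp
    qed (use S in simp)
    \<comment> \<open>For \<open>r = 0\<close> the truncated \<open>r - 1\<close> is harmless:
      \<open>lev 1 = 1\<close>, so a skip has probability 0.\<close>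
    moreover have "(1 - lev ?g) * visits j (r - 1) = 1 - lev ?g"
      using True by (cases r) (auto simp: lev_1 visits_def)
    moreover have "1 + of_bool (r = j) \<le> visits j r" using True by (auto simp: visits_def divide_simps)
    ultimately show ?thesis by linarith
  next
    case False
    define x where "x = real r"
    define y where "y = 3 * real j + 5"
    have x: "1 \<le> x" and y: "0 < y" using False by (auto simp: x_def y_def add_nonneg_pos)
    have l: "lev ?g = 8 / (6 * x + 8)" by (simp add: lev_def x_def algebra_simps)
    have v: "visits j (r - 1) = 2 * y / (3 * x + 2)" "visits j r = 2 * y / (3 * x + 5)"
      using False by (auto simp: visits_def x_def y_def of_nat_diff algebra_simps)
    have "?S \<le> y * (8 / (6 * x + 8) / (6 * x + 5))"
    proof -
      have "3 * real ?g + 2 = 6 * x + 5" by (simp add: x_def)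
      then show ?thesis using S False unfolding l y_def[symmetric] by (simp add: ac_simps)
    qed
    moreover have "(1 - 8 / (6 * x + 8)) * (2 / (3 * x + 2)) + 8 / (6 * x + 8) / (6 * x + 5) \<le> 2 / (3 * x + 5)"
      using x by (simp add: divide_simps) (simp add: algebra_simps power2_eq_square power3_eq_cube)
    from mult_left_mono[OF this less_imp_le[OF y]]
    have "(1 - 8 / (6 * x + 8)) * (2 * y / (3 * x + 2)) + y * (8 / (6 * x + 8) / (6 * x + 5)) \<le> 2 * y / (3 * x + 5)"
      by (simp add: algebra_simps)
    ultimately show ?thesis using False unfolding l v by simp
  qed
qed

text \<open>A contract of length \<open>k\<close> is charged \<open>k\<close> and moves the state to
  \<open>k - 1\<close>, so the charge and the change of the potential cancel up to 1 and every uncut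
  contract contributes the same amount.\<close>

lemma total_supersolution:
  assumes "r < m"
  shows "(1 - lev (2*r+1)) * (11/7 * real (m - 1) - real (r - 1))
      + (\<Sum>k=2*r+1..<m. (lev k - lev (Suc k)) * (real k + (11/7 * real (m - 1) - real (k - 1))))
      + lev (max (2*r+1) m) * real m \<le> 11/7 * real m - real r"
proof -
  define g where "g = 2*r+1"
  define a where "a = lev g"
  define b where "b = lev (max g m)"
  obtain y where m: "m = Suc y" and y: "r \<le> y" using assms by (cases m) auto
  have a: "a = 8 / (6 * real r + 8)" by (simp add: a_def g_def lev_def algebra_simps)
  have "(\<Sum>k=g..<m. (lev k - lev (Suc k)) * (real k + (11/7 * real y - real (k - 1))))
      = (\<Sum>k=g..<m. (lev k - lev (Suc k)) * (11/7 * real y + 1))"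
    by (intro sum.cong) (auto simp: g_def of_nat_diff)
  also have "\<dots> = (a - b) * (11/7 * real y + 1)"
  proof -
    have "(\<Sum>k=g..<m. lev k - lev (Suc k)) = a - b"
      using sum_Suc_diff'[of g m "\<lambda>k. - lev k"] by (cases "g \<le> m") (simp_all add: a_def b_def max_def)
    then show ?thesis by (simp flip: sum_distrib_right)
  qed
  finally have S: "(\<Sum>k=g..<m. (lev k - lev (Suc k)) * (real k + (11/7 * real y - real (k - 1))))
      = (a - b) * (11/7 * real y + 1)" .
  have r1: "(1 - a) * real (r - 1) = (1 - a) * (real r - 1)"
    by (cases r) (simp_all add: a of_nat_diff)
  have ar: "a * real r \<le> 4/3" by (simp add: a divide_simps)
  have "a * real r \<le> b * real y"
  proof (cases "m \<le> g")
    case True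
    then have "b = a" by (simp add: a_def b_def)
    then show ?thesis using y lev_pos[of g] by (simp add: a_def mult_left_mono)
  next
    case False
    then have b: "b = 8 / (3 * real y + 8)" by (simp add: b_def lev_def m algebra_simps)
    have "real r * (3 * real y + 8) \<le> real y * (6 * real r + 8)"
    proof -
      have "real y * (6 * real r + 8) - real r * (3 * real y + 8) = 3 * (real r * real y) + 8 * (real y - real r)"
        by (simp add: algebra_simps)
      moreover have "0 \<le> 3 * (real r * real y) + 8 * (real y - real r)" using y by simp
      ultimately show ?thesis by linarith
    qed
    then show ?thesis unfolding a b by (simp add: divide_le_eq le_divide_eq mult.commute)
  qed
  \<comment> \<open>Origin of \<open>11/7\<close>: with \<open>c\<close> in its place the slack is
    \<open>(c - 1) - a * r + (c - 1) * b * y\<close>. By \<open>a * r \<le> b * y\<close> and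
    \<open>a * r \<le> 4/3\<close> it is at least \<open>(c - 1) - (2 - c) * 4/3\<close>, which
    vanishes at \<open>c = 11/7\<close>.\<close>
  moreover have "(1 - a) * (11/7 * real y - (real r - 1)) + (a - b) * (11/7 * real y + 1) + b * (real y + 1)
      = 11/7 * (real y + 1) - real r - (4/7 - a * real r + 4/7 * (b * real y))"
    by (simp add: field_simps)
  ultimately have "(1 - a) * (11/7 * real y - (real r - 1)) + (a - b) * (11/7 * real y + 1) + b * (real y + 1)
      \<le> 11/7 * (real y + 1) - real r"
    using ar by linarith
  then show ?thesis
    using S r1 unfolding g_def[symmetric] a_def[symmetric] b_def[symmetric]
    by (simp add: m right_diff_distrib add.commute)
qed

section \<open>The potential at a fixed quantile and its one-step inequality\<close>

interpretation unif: prob_space unif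
  by (auto simp: emeasure_density intro!: prob_spaceI)

text \<open>\<open>fee v j\<close> is the expected length hired above quantile \<open>v\<close> in a step at which \<open>j\<close> steps are
  covered.\<close>

definition fee :: "real \<Rightarrow> nat \<Rightarrow> ennreal" where
  "fee v j = (\<integral>\<^sup>+u. ennreal (real (dur u)) * of_bool (v < u \<and> 2 * j + 1 \<le> dur u) \<partial>unif)"

text \<open>Dominates the expected remaining length of contracts above quantile \<open>v\<close>. If \<open>v < 2 / n\<close>, it
  bounds the total remaining length instead.\<close>

definition potential :: "nat \<Rightarrow> real \<Rightarrow> nat \<Rightarrow> nat \<Rightarrow> ennreal" where
  "potential n v r m = (if m \<le> r then 0
     else if 2 \<le> real n * v then \<Sum>j<n. ennreal (visits j r) * fee v j
     else ennreal (11/7 * real m - real r))"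

lemma measurable_fee [measurable]: "(\<lambda>v. fee v j) \<in> borel_measurable borel"
  unfolding fee_def by measurable

lemma measurable_potential [measurable]: "(\<lambda>v. potential n v r m) \<in> borel_measurable borel"
  unfolding potential_def by measurable

text \<open>Linearity: the inequality for \<open>visits j\<close> is weighted with
  \<open>fee v j\<close> and summed over \<open>j\<close>. The current step costs at most
  \<open>fee v r\<close>, which is one of the weights because \<open>r < n\<close>.\<close>

lemma potential_step_visits:
  assumes "r < m" "m \<le> n" and v: "2 \<le> real n * v"
  shows "(\<integral>\<^sup>+u. ennreal (real (hire r m u)) * of_bool (v < u) + potential n v (max r (hire r m u) - 1) (m - 1) \<partial>unif)
     \<le> potential n v r m"
proof -
  let ?g = "2 * r + 1"
  define H where "H T = potential n v (max r T - 1) (m - 1)" for T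
  define W where "W r = (\<Sum>j<n. ennreal (visits j r) * fee v j)" for r
  have potentialW: "potential n v r' m' \<le> W r'" for r' m'
    using v by (simp add: potential_def W_def)
  \<comment> \<open>A contract up to the horizon leaves all remaining \<open>m - 1\<close> steps
    covered, where the potential is 0.\<close>
  have Hm: "H m = 0" using assms by (simp add: H_def potential_def)
  have "(\<integral>\<^sup>+u. ennreal (real (hire r m u)) * of_bool (v < u) + H (hire r m u) \<partial>unif)
      = (\<integral>\<^sup>+u. ennreal (real (hire r m u)) * of_bool (v < u) \<partial>unif) + (\<integral>\<^sup>+u. H (hire r m u) \<partial>unif)"
    by (intro nn_integral_add) measurable
  also have "(\<integral>\<^sup>+u. ennreal (real (hire r m u)) * of_bool (v < u) \<partial>unif) \<le> fee v r"
    unfolding fee_def by (intro nn_integral_mono) (auto simp: hire_def)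
  also have "(\<integral>\<^sup>+u. H (hire r m u) \<partial>unif)
      \<le> ennreal (1 - lev ?g) * H 0 + (\<Sum>k=?g..<m. ennreal (lev k - lev (Suc k)) * H k)"
    using nn_integral_hire_le[of H r m] by (simp add: Hm)
  also have "\<dots> \<le> ennreal (1 - lev ?g) * W (r - 1) + (\<Sum>k=?g..<m. ennreal (lev k - lev (Suc k)) * W (k - 1))"
  proof (intro add_mono mult_left_mono sum_mono)
    show "H 0 \<le> W (r - 1)" using potentialW by (simp add: H_def)
    show "H k \<le> W (k - 1)" if "k \<in> {?g..<m}" for k
      using potentialW[of "k - 1"] that by (simp add: H_def max_def)
  qed auto
  also have "\<dots> = (\<Sum>j<n. ennreal ((1 - lev ?g) * visits j (r - 1)
      + (\<Sum>k=?g..<m. (lev k - lev (Suc k)) * visits j (k - 1))) * fee v j)"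
  proof -
    have "ennreal ((1 - lev ?g) * visits j (r - 1) + (\<Sum>k=?g..<m. (lev k - lev (Suc k)) * visits j (k - 1))) * fee v j
       = ennreal (1 - lev ?g) * (ennreal (visits j (r - 1)) * fee v j)
         + (\<Sum>k=?g..<m. ennreal (lev k - lev (Suc k)) * (ennreal (visits j (k - 1)) * fee v j))" for j
      using lev_le_1[of ?g]
      by (simp add: ennreal_plus ennreal_mult visits_nonneg lev_antimono sum_nonneg
          sum_ennreal[symmetric] distrib_right sum_distrib_right mult.assoc del: ennreal_plus[symmetric])
    then show ?thesis
      unfolding W_def by (simp add: sum.distrib sum_distrib_left sum.swap[of _ "{..<n}"])
  qed
  also have "fee v r = (\<Sum>j<n. ennreal (of_bool (r = j)) * fee v j)"
    using assms by (simp add: of_bool_def if_distrib if_distribR cong: if_cong)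
  also have "(\<Sum>j<n. ennreal (of_bool (r = j)) * fee v j) + (\<Sum>j<n. ennreal ((1 - lev ?g) * visits j (r - 1)
      + (\<Sum>k=?g..<m. (lev k - lev (Suc k)) * visits j (k - 1))) * fee v j)
      = (\<Sum>j<n. ennreal (of_bool (r = j) + (1 - lev ?g) * visits j (r - 1)
      + (\<Sum>k=?g..<m. (lev k - lev (Suc k)) * visits j (k - 1))) * fee v j)"
    unfolding sum.distrib[symmetric] distrib_right[symmetric]
    using lev_le_1[of ?g]
    by (subst ennreal_plus[symmetric])
      (auto intro!: add_nonneg_nonneg sum_nonneg mult_nonneg_nonneg simp: visits_nonneg lev_antimono add.assoc)
  also have "\<dots> \<le> (\<Sum>j<n. ennreal (visits j r) * fee v j)"
    by (intro sum_mono mult_right_mono ennreal_leI visits_supersolution) auto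
  also have "\<dots> = potential n v r m" using assms by (simp add: potential_def)
  finally show ?thesis by (simp add: H_def add_mono)
qed

text \<open>In this regime the indicator of \<open>v < u\<close> is bounded by 1 and every hired
  step is charged, which reduces the claim to \<open>total_supersolution\<close>.\<close>

lemma potential_step_total:
  assumes "r < m" and v: "\<not> 2 \<le> real n * v"
  shows "(\<integral>\<^sup>+u. ennreal (real (hire r m u)) * of_bool (v < u) + potential n v (max r (hire r m u) - 1) (m - 1) \<partial>unif)
     \<le> potential n v r m"
proof -
  let ?g = "2 * r + 1"
  define H where "H T = ennreal (real T) + potential n v (max r T - 1) (m - 1)" for T
  have Hm: "H m = ennreal (real m)" using assms by (simp add: H_def potential_def)
  have Hk: "H k \<le> ennreal (real k + (11/7 * real (m - 1) - real (k - 1)))" if "k \<in> {?g..<m}" for k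
  proof -
    have "max r k = k" "k - 1 < m - 1" "1 \<le> k" using that by auto
    then show ?thesis using v
      by (auto simp: H_def potential_def not_le simp flip: ennreal_plus)
  qed
  \<comment> \<open>For \<open>r = 0\<close> both sides are 0, since
    \<open>lev 1 = 1\<close>.\<close>
  have H0: "ennreal (1 - lev ?g) * H 0 \<le> ennreal ((1 - lev ?g) * (11/7 * real (m - 1) - real (r - 1)))"
  proof (cases r)
    case 0
    then show ?thesis by (simp add: lev_1)
  next
    case (Suc r')
    then show ?thesis using v assms lev_le_1[of ?g] by (simp add: H_def potential_def ennreal_mult')
  qed
  have "(\<integral>\<^sup>+u. ennreal (real (hire r m u)) * of_bool (v < u) + potential n v (max r (hire r m u) - 1) (m - 1) \<partial>unif)
      \<le> (\<integral>\<^sup>+u. H (hire r m u) \<partial>unif)"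
    unfolding H_def by (intro nn_integral_mono add_right_mono) auto
  also have "\<dots> \<le> ennreal (1 - lev ?g) * H 0 + (\<Sum>k=?g..<m. ennreal (lev k - lev (Suc k)) * H k)
      + ennreal (lev (max ?g m)) * H m"
    by (rule nn_integral_hire_le)
  also have "\<dots> \<le> ennreal ((1 - lev ?g) * (11/7 * real (m - 1) - real (r - 1)))
     + (\<Sum>k=?g..<m. ennreal (lev k - lev (Suc k)) * ennreal (real k + (11/7 * real (m - 1) - real (k - 1))))
      + ennreal (lev (max ?g m)) * ennreal (real m)"
    by (intro add_mono H0 sum_mono mult_left_mono Hk) (auto simp: Hm)
  also have "\<dots> = ennreal ((1 - lev ?g) * (11/7 * real (m - 1) - real (r - 1))
     + (\<Sum>k=?g..<m. (lev k - lev (Suc k)) * (real k + (11/7 * real (m - 1) - real (k - 1))))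
      + lev (max ?g m) * real m)"
  proof -
    have a: "0 \<le> (1 - lev ?g) * (11/7 * real (m - 1) - real (r - 1))"
      using assms lev_le_1[of ?g] by (intro mult_nonneg_nonneg) auto
    have b: "0 \<le> (lev k - lev (Suc k)) * (real k + (11/7 * real (m - 1) - real (k - 1)))" for k
      by (intro mult_nonneg_nonneg) (auto simp: lev_antimono)
    have eq: "(\<Sum>k=?g..<m. ennreal (lev k - lev (Suc k)) * ennreal (real k + (11/7 * real (m - 1) - real (k - 1))))
       = ennreal (\<Sum>k=?g..<m. (lev k - lev (Suc k)) * (real k + (11/7 * real (m - 1) - real (k - 1))))"
      by (subst sum_ennreal[symmetric]) (auto simp: b ennreal_mult' lev_antimono)
    have add3: "ennreal x + ennreal y + ennreal l * ennreal z = ennreal (x + y + l * z)"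
      if "0 \<le> x" "0 \<le> y" "0 \<le> l" "0 \<le> z" for x y l z
      using that by (simp add: ennreal_mult)
    show ?thesis
      unfolding eq by (rule add3[OF a sum_nonneg[OF b] less_imp_le[OF lev_pos]]) simp
  qed
  also have "\<dots> \<le> ennreal (11/7 * real m - real r)"
    by (intro ennreal_leI total_supersolution assms)
  also have "\<dots> = potential n v r m" using assms by (simp add: potential_def)
  finally show ?thesis .
qed

lemma potential_step:
  assumes "r < m" "m \<le> n"
  shows "(\<integral>\<^sup>+u. ennreal (real (hire r m u)) * of_bool (v < u) + potential n v (max r (hire r m u) - 1) (m - 1) \<partial>unif)
     \<le> potential n v r m"
  using potential_step_visits[OF assms] potential_step_total[OF assms(1)] by blast

section \<open>The initial potential against the value of the optimum\<close>

text \<open>From \<open>r = 0\<close>, state 0 counts twice and every other state once; an item of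
  duration \<open>d\<close> is accepted in the \<open>(d + 1) div 2\<close> states with
  \<open>2 * j + 1 \<le> d\<close>.\<close>

lemma sum_visits_le:
  assumes "1 \<le> d"
  shows "(\<Sum>j<n. visits j 0 * of_bool (2 * j + 1 \<le> d)) \<le> (real d + 3) / 2"
proof -
  have "(\<Sum>j<n. visits j 0 * of_bool (2 * j + 1 \<le> d))
      \<le> (\<Sum>j<n. of_bool (j = 0) + of_bool (2 * j + 1 \<le> d))"
    by (intro sum_mono) (auto simp: visits_def)
  also have "\<dots> \<le> 1 + real (card {j. 2 * j + 1 \<le> d})"
  proof -
    have fin: "finite {j. 2 * j + 1 \<le> d}" by (rule finite_subset[of _ "{..d}"]) auto
    have "(\<Sum>j<n. of_bool (j = 0)) \<le> (1::real)"
      by (simp add: sum.If_cases of_bool_def)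
    moreover have "(\<Sum>j<n. of_bool (2 * j + 1 \<le> d)) = real (card ({..<n} \<inter> {j. 2 * j + 1 \<le> d}))"
      by (simp add: of_bool_def sum.If_cases)
    moreover have "card ({..<n} \<inter> {j. 2 * j + 1 \<le> d}) \<le> card {j. 2 * j + 1 \<le> d}"
      by (intro card_mono fin) auto
    ultimately show ?thesis by (simp add: sum.distrib)
  qed
  also have "{j. 2 * j + 1 \<le> d} = {..<(d + 1) div 2}" by auto
  finally show ?thesis by (simp add: field_simps)
qed

text \<open>Exchanging sum and integral, an item of duration \<open>d\<close> contributes at most
  \<open>d * (d + 3) / 2\<close>. As \<open>d\<close> is at most \<open>(8/u - 5)/3\<close>, the
  leading coefficient of \<open>1 / u^2\<close> is \<open>(8/3)^2 / 2 = 32/9\<close>, and this is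
  integrated from \<open>v\<close> to 1.\<close>

lemma fee_total_le:
  assumes v: "0 < v" "v \<le> 1"
  shows "(\<Sum>j<n. ennreal (visits j 0) * fee v j) \<le> ennreal (32/9 * (1/v - 1))"
proof -
  have "(\<Sum>j<n. ennreal (visits j 0) * fee v j)
      = (\<integral>\<^sup>+u. (\<Sum>j<n. ennreal (visits j 0) * (ennreal (real (dur u)) * of_bool (v < u \<and> 2 * j + 1 \<le> dur u))) \<partial>unif)"
    unfolding fee_def by (subst nn_integral_sum) (auto simp: nn_integral_cmult)
  also have "\<dots> = (\<integral>\<^sup>+u. (\<Sum>j<n. ennreal (visits j 0) * (ennreal (real (dur u)) * of_bool (v < u \<and> 2 * j + 1 \<le> dur u)))
     * indicator {0<..<1} u \<partial>lborel)"
    by (intro nn_integral_unif) measurable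
  also have "\<dots> \<le> (\<integral>\<^sup>+u. ennreal (32/9 / u\<^sup>2) * indicator {v..1} u \<partial>lborel)"
  proof (intro nn_integral_mono)
    fix u :: real
    show "(\<Sum>j<n. ennreal (visits j 0) * (ennreal (real (dur u)) * of_bool (v < u \<and> 2 * j + 1 \<le> dur u)))
     * indicator {0<..<1} u \<le> ennreal (32/9 / u\<^sup>2) * indicator {v..1} u"
    proof (cases "v < u \<and> u < 1")
      case True
      then have u: "0 < u" "u \<le> 1" using v by auto
      let ?d = "dur u"
      have "(\<Sum>j<n. ennreal (visits j 0) * (ennreal (real ?d) * of_bool (v < u \<and> 2 * j + 1 \<le> ?d)))
         = (\<Sum>j<n. ennreal (visits j 0 * (real ?d * of_bool (2 * j + 1 \<le> ?d))))"
        using True by (intro sum.cong) (auto simp: ennreal_mult visits_nonneg)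
      also have "\<dots> = ennreal (\<Sum>j<n. visits j 0 * (real ?d * of_bool (2 * j + 1 \<le> ?d)))"
        by (intro sum_ennreal) (simp add: visits_nonneg)
      also have "\<dots> \<le> ennreal (32/9 / u\<^sup>2)"
      proof (rule ennreal_leI)
        have d: "real ?d \<le> (8/u - 5)/3"
          using dur_ge_1[OF u] unfolding dur_def by linarith
        have "(\<Sum>j<n. visits j 0 * (real ?d * of_bool (2 * j + 1 \<le> ?d)))
            = real ?d * (\<Sum>j<n. visits j 0 * of_bool (2 * j + 1 \<le> ?d))"
          unfolding sum_distrib_left by (intro sum.cong) auto
        also have "\<dots> \<le> real ?d * ((real ?d + 3) / 2)"
          by (intro mult_left_mono sum_visits_le dur_ge_1 u) auto
        also have "\<dots> \<le> (8/u - 5)/3 * (((8/u - 5)/3 + 3) / 2)"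
          using d by (intro mult_mono) auto
        \<comment> \<open>The shift by 5 in \<open>dur\<close> makes the term in \<open>1/u\<close>
          negative, so only the leading term is kept.\<close>
        also have "\<dots> = 32/9 / u\<^sup>2 - (4/9) / u - 10/9"
          using u by (simp add: field_simps power2_eq_square)
        also have "\<dots> \<le> 32/9 / u\<^sup>2"
        proof -
          have "0 \<le> (4/9) / u" using u by simp
          then show ?thesis by linarith
        qed
        finally show "(\<Sum>j<n. visits j 0 * (real ?d * of_bool (2 * j + 1 \<le> ?d))) \<le> 32/9 / u\<^sup>2" .
      qed
      finally show ?thesis using True u by simp
    qed (auto simp: indicator_def)
  qed
  also have "\<dots> = ennreal ((- (32/9) / 1) - (- (32/9) / v))"
    using v
    by (intro nn_integral_FTC_Icc)
      (auto intro!: derivative_eq_intros simp: power2_eq_square has_real_derivative_iff_has_vector_derivative[symmetric])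
  also have "\<dots> = ennreal (32/9 * (1/v - 1))"
    by (rule arg_cong[of _ _ ennreal]) (simp add: field_simps)
  finally show ?thesis .
qed

lemma sum_geometric:
  fixes p :: real
  assumes "p \<noteq> 1"
  shows "(\<Sum>i<n. p ^ Suc i) = p * (1 - p ^ n) / (1 - p)"
  using assms by (simp flip: sum_distrib_left add: sum_gp_strict)

text \<open>For \<open>2 \<le> n * v\<close> the geometric sum is at least
  \<open>6/7 * (1/v - 1)\<close>, and \<open>32/9 * 7/6 < 4.149\<close>. The sum decreases in
  \<open>v\<close>, so for smaller \<open>v\<close> it is at least its value at \<open>2/n\<close>,
  hence at least \<open>6/7 * (n/2 - 1)\<close>; as \<open>4.179 * 3/7 > 11/7\<close>, the loss from
  the \<open>-1\<close> is absorbed once \<open>n \<ge> 20\<close>.\<close>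

lemma potential_0_le:
  assumes n: "20 \<le> n" and v: "0 \<le> v" "v \<le> 1"
  shows "potential n v 0 n \<le> ennreal (4.179 * (\<Sum>i<n. (1 - v) ^ Suc i))"
proof -
  have e2: "(1 - x) ^ n \<le> 1/7" if x: "2 \<le> real n * x" "x \<le> 1" for x :: real
  proof -
    have "(1 - x) ^ n \<le> exp (- x) ^ n"
      using that exp_ge_add_one_self[of "-x"] by (intro power_mono) auto
    also have "\<dots> = exp (- (real n * x))" by (simp add: exp_of_nat_mult[symmetric])
    also have "\<dots> \<le> exp (-2)" using x by simp
    also have "\<dots> \<le> 1/7"
    proof -
      \<comment> \<open>The power is \<open>1.05^40\<close>, about 7.04.\<close>
      have "7 \<le> (1 + 2 / real 40) ^ 40" by (simp add: power_divide)
      also have "\<dots> \<le> exp (2::real)" by (rule exp_ge_one_plus_x_over_n_power_n) auto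
      finally show ?thesis by (simp add: exp_minus field_simps)
    qed
    finally show ?thesis .
  qed
  show ?thesis
  proof (cases "2 \<le> real n * v")
    case True
    then have v0: "0 < v" using n v by (cases "v = 0") auto
    have "potential n v 0 n \<le> ennreal (32/9 * (1/v - 1))"
      using fee_total_le[OF v0 v(2)] True n by (simp add: potential_def)
    also have "\<dots> \<le> ennreal (4.179 * (\<Sum>i<n. (1 - v) ^ Suc i))"
    proof (rule ennreal_leI)
      have "32/9 \<le> 4.179 * (1 - (1 - v) ^ n)" using e2[OF True v(2)] by simp
      then have "32/9 * ((1 - v) / v) \<le> 4.179 * (1 - (1 - v) ^ n) * ((1 - v) / v)"
        using v0 v by (intro mult_right_mono) auto
      then show "32/9 * (1/v - 1) \<le> 4.179 * (\<Sum>i<n. (1 - v) ^ Suc i)"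
        using v0 by (simp add: sum_geometric del: power_Suc) (simp add: field_simps)
    qed
    finally show ?thesis .
  next
    case False
    define x where "x = 2 / real n"
    have x: "0 < x" "x < 1" "real n * x = 2" using n by (auto simp: x_def)
    have vx: "v \<le> x" using False n by (simp add: x_def field_simps)
    have "11/7 * real n \<le> 4.179 * ((real n / 2 - 1) * (1 - 1/7))" using n by simp
    also have "\<dots> \<le> 4.179 * ((real n / 2 - 1) * (1 - (1 - x)^n))"
      using e2[of x] x n by (intro mult_left_mono) auto
    also have "(real n / 2 - 1) * (1 - (1 - x)^n) = (\<Sum>i<n. (1 - x) ^ Suc i)"
      using x n by (simp add: sum_geometric del: power_Suc) (simp add: x_def field_simps)
    also have "4.179 * \<dots> \<le> 4.179 * (\<Sum>i<n. (1 - v) ^ Suc i)"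
      using vx x v by (intro mult_left_mono sum_mono power_mono) auto
    finally show ?thesis using False n by (auto simp: potential_def intro!: ennreal_leI)
  qed
qed

section \<open>The deterministic algorithm and its validity\<close>

text \<open>A cost \<open>x\<close> is the measure of the levels \<open>s \<ge> 0\<close> below it, and level \<open>s\<close> corresponds to the
  quantile \<open>cdf M s\<close>.\<close>

definition layered_potential :: "real measure \<Rightarrow> nat \<Rightarrow> nat \<Rightarrow> nat \<Rightarrow> ennreal" where
  "layered_potential M n r m = (\<integral>\<^sup>+s. potential n (cdf M s) r m * indicator {0..} s \<partial>lborel)"

definition choices :: "nat \<Rightarrow> nat \<Rightarrow> nat set" where
  "choices r m = {(if r = 0 then 1 else 0)..m}"

definition lookahead :: "real measure \<Rightarrow> nat \<Rightarrow> nat \<Rightarrow> nat \<Rightarrow> real \<Rightarrow> nat \<Rightarrow> ennreal" where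
  "lookahead M n r m x t = ennreal (real t * x) + layered_potential M n (max r t - 1) (m - 1)"

text \<open>Atoms of the distribution would force a quantile rule to randomise. Minimising the lookahead
  cost pointwise is deterministic and at least as good.\<close>

definition decide :: "real measure \<Rightarrow> nat \<Rightarrow> nat \<Rightarrow> nat \<Rightarrow> real \<Rightarrow> nat" where
  "decide M n r m x = (LEAST t. t \<in> choices r m
     \<and> (\<forall>t'\<in>choices r m. lookahead M n r m x t \<le> lookahead M n r m x t'))"

text \<open>Number of steps from \<open>i\<close> on that are already covered. The maximum is taken
  because overlapping contracts do not add up; the 1 is the step that passes.\<close>

primrec covered :: "real measure \<Rightarrow> nat \<Rightarrow> (nat \<Rightarrow> real) \<Rightarrow> nat \<Rightarrow> nat" where
  "covered M n x 0 = 0"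
| "covered M n x (Suc i) = max (covered M n x i) (decide M n (covered M n x i) (n - i) (x i)) - 1"

text \<open>The state is recomputed from the observed prefix, whose last entry is the current
  value.\<close>

definition greedy :: policy where
  "greedy M n xs = (let i = length xs - 1 in decide M n (covered M n ((!) xs) i) (n - i) (xs ! i))"

lemma decide_optimal:
  assumes "1 \<le> m"
  shows "decide M n r m x \<in> choices r m"
    and "t \<in> choices r m \<Longrightarrow> lookahead M n r m x (decide M n r m x) \<le> lookahead M n r m x t"
proof -
  have "finite (choices r m)" "choices r m \<noteq> {}" using assms by (auto simp: choices_def)
  from ex_is_arg_min_if_finite[OF this, of "lookahead M n r m x"]
  have "\<exists>t. t \<in> choices r m \<and> (\<forall>t'\<in>choices r m. lookahead M n r m x t \<le> lookahead M n r m x t')"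
    by (auto simp: is_arg_min_linorder)
  from LeastI_ex[OF this] show "decide M n r m x \<in> choices r m"
    and "t \<in> choices r m \<Longrightarrow> lookahead M n r m x (decide M n r m x) \<le> lookahead M n r m x t"
    unfolding decide_def by blast+
qed

lemma measurable_decide [measurable]: "decide M n r m \<in> measurable borel (count_space UNIV)"
proof -
  have "finite (choices r m)" by (simp add: choices_def)
  then show ?thesis unfolding decide_def lookahead_def by measurable
qed

text \<open>Non-anticipation: it allows an observed prefix, or a sample with a later coordinate
  replaced, to stand for the whole sequence.\<close>

lemma covered_cong: "(\<And>k. k < i \<Longrightarrow> x k = y k) \<Longrightarrow> covered M n x i = covered M n y i"
  by (induction i) auto

lemma T_greedy: "T greedy M n x i = decide M n (covered M n x i) (n - i) (x i)"
proof -
  have "covered M n ((!) (map x [0..<Suc i])) i = covered M n x i"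
    by (rule covered_cong) (simp del: upt_Suc)
  then show ?thesis by (simp add: T_def greedy_def Let_def del: upt_Suc)
qed

lemma measurable_covered:
  assumes M: "sets M' = sets borel" and "i \<le> k"
  shows "(\<lambda>x. covered M n x i) \<in> measurable (PiM {..<k} (\<lambda>_. M')) (count_space UNIV)"
  using assms(2)
proof (induction i)
  case (Suc i)
  have [measurable]: "(\<lambda>x. covered M n x i) \<in> measurable (PiM {..<k} (\<lambda>_. M')) (count_space UNIV)"
    using Suc by simp
  have "(\<lambda>x. x i) \<in> measurable (PiM {..<k} (\<lambda>_. M')) M'"
    using Suc by (intro measurable_component_singleton) auto
  then have [measurable]: "(\<lambda>x. x i) \<in> measurable (PiM {..<k} (\<lambda>_. M')) borel"
    using M by (simp cong: measurable_cong_sets)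
  have "(\<lambda>x. decide M n (covered M n x i) (n - i) (x i)) \<in> measurable (PiM {..<k} (\<lambda>_. M')) (count_space UNIV)"
    by (rule measurable_compose_countable[where g="\<lambda>x. covered M n x i"]) measurable
  note [measurable] = this
  show ?case by simp
qed simp

lemma measurable_greedy:
  assumes M: "sets M' = sets borel" and "i < k"
  shows "(\<lambda>x. T greedy M n x i) \<in> measurable (PiM {..<k} (\<lambda>_. M')) (count_space UNIV)"
proof -
  have [measurable]: "(\<lambda>x. covered M n x i) \<in> measurable (PiM {..<k} (\<lambda>_. M')) (count_space UNIV)"
    using measurable_covered[OF M] assms(2) by simp
  have "(\<lambda>x. x i) \<in> measurable (PiM {..<k} (\<lambda>_. M')) M'"
    using assms by (intro measurable_component_singleton) auto
  then have [measurable]: "(\<lambda>x. x i) \<in> measurable (PiM {..<k} (\<lambda>_. M')) borel"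
    using M by (simp cong: measurable_cong_sets)
  show ?thesis unfolding T_greedy
    by (rule measurable_compose_countable[where g="\<lambda>x. covered M n x i"]) measurable
qed

text \<open>Positive coverage always comes from a single earlier contract that ends exactly where
  the coverage ends. With coverage 0, \<open>choices\<close> forces a length of at least 1.\<close>

lemma greedy_covers:
  assumes "i < n"
  shows "\<exists>j\<le>i. i < j + T greedy M n x j"
proof -
  have inv: "0 < covered M n x i \<Longrightarrow> \<exists>j<i. j + T greedy M n x j = i + covered M n x i" for i
  proof (induction i)
    case (Suc i)
    show ?case
    proof (cases "covered M n x i \<le> T greedy M n x i")
      case True
      then show ?thesis using Suc.prems by (intro exI[of _ i]) (auto simp: T_greedy)
    next
      case False
      then obtain j where "j < i" "j + T greedy M n x j = i + covered M n x i" using Suc.IH by auto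
      then show ?thesis using False Suc.prems by (intro exI[of _ j]) (auto simp: T_greedy)
    qed
  qed simp
  show ?thesis
  proof (cases "covered M n x i = 0")
    case True
    then have "1 \<le> T greedy M n x i"
      using decide_optimal(1)[of "n - i" M n 0 "x i"] assms by (simp add: T_greedy choices_def)
    then show ?thesis by (intro exI[of _ i]) auto
  next
    case False
    then obtain j where "j < i" "j + T greedy M n x j = i + covered M n x i" using inv by auto
    then show ?thesis using False by (intro exI[of _ j]) auto
  qed
qed

lemma valid_greedy: "valid_alg greedy"
  unfolding valid_alg_def sample_def distF_def using measurable_greedy greedy_covers by blast

lemma distF_real_distribution: "distF M \<Longrightarrow> real_distribution M"
  by (auto simp: distF_def real_distribution_def real_distribution_axioms_def dest: sets_eq_imp_space_eq)

section \<open>Expected cost of the algorithm\<close>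

text \<open>The value is written as \<open>I u\<close> with \<open>u\<close> uniform and
  \<open>I\<close> the pseudoinverse of the CDF. The quantile rule at \<open>u\<close> is an
  admissible competitor, so the minimiser does at least as well for each \<open>u\<close>. After
  exchanging the integrals over quantiles and levels, \<open>potential_step\<close> applies at each
  level \<open>s\<close> with \<open>v = cdf M s\<close>.\<close>

lemma decide_step:
  assumes M: "distF M" and m: "1 \<le> m" "m \<le> n"
  shows "(\<integral>\<^sup>+x. lookahead M n r m x (decide M n r m x) \<partial>M) \<le> layered_potential M n r m"
proof (cases "r < m")
  case False
  \<comment> \<open>With everything up to the horizon covered, length 0 is free and leads to
    potential 0.\<close>
  then have "lookahead M n r m x 0 = 0" for x
  proof -
    have "m - 1 \<le> max r 0 - 1" using False by simp
    then show ?thesis by (simp add: lookahead_def layered_potential_def potential_def)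
  qed
  moreover have "lookahead M n r m x (decide M n r m x) \<le> lookahead M n r m x 0" for x
    using False m by (intro decide_optimal) (auto simp: choices_def)
  ultimately have "lookahead M n r m x (decide M n r m x) = 0" for x
    by simp
  then show ?thesis by simp
next
  case r: True
  interpret real_distribution M by (rule distF_real_distribution) fact
  interpret cdf_distribution M by standard
  interpret pair_sigma_finite unif lborel ..
  define f where "f u s = (ennreal (real (hire r m u)) * of_bool (cdf M s < u)
      + potential n (cdf M s) (max r (hire r m u) - 1) (m - 1)) * indicator {0..} s" for u s
  have [measurable]: "(\<lambda>(u, s). potential n (cdf M s) (max r (hire r m u) - 1) (m - 1))
      \<in> borel_measurable (borel \<Otimes>\<^sub>M borel)"
    unfolding split_beta'
    by (rule measurable_compose_countable[where g="\<lambda>p. hire r m (fst p)"]) measurable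
  have meas: "case_prod f \<in> borel_measurable (borel \<Otimes>\<^sub>M borel)"
    unfolding f_def split_beta' by measurable
  have bound: "lookahead M n r m (I u) (decide M n r m (I u)) \<le> (\<integral>\<^sup>+s. f u s \<partial>lborel)"
    if u: "0 < u" "u < 1" for u
  proof -
    let ?t = "hire r m u"
    \<comment> \<open>In state 0 the quantile rule never skips, since \<open>dur u \<ge> 1\<close>
      on the unit interval.\<close>
    have "?t \<in> choices r m"
      using dur_ge_1[of u] u m by (auto simp: choices_def hire_def)
    then have "lookahead M n r m (I u) (decide M n r m (I u)) \<le> lookahead M n r m (I u) ?t"
      by (rule decide_optimal(2)[OF m(1)])
    also have "\<dots> = (\<integral>\<^sup>+s. f u s \<partial>lborel)"
    proof -
      \<comment> \<open>Layer-cake formula: the levels below \<open>I u\<close> are those with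
        \<open>cdf M s < u\<close>.\<close>
      have "ennreal (real ?t * I u) = (\<integral>\<^sup>+s. ennreal (real ?t) * of_bool (cdf M s < u) * indicator {0..} s \<partial>lborel)"
      proof -
        have lt: "cdf M s < u \<longleftrightarrow> s < I u" for s
          using pseudoinverse[of u s] u by (simp add: not_le[symmetric])
        have "(\<integral>\<^sup>+s. ennreal (real ?t) * of_bool (cdf M s < u) * indicator {0..} s \<partial>lborel)
           = (\<integral>\<^sup>+s. ennreal (real ?t) * indicator {0..<I u} s \<partial>lborel)"
          by (intro nn_integral_cong) (auto simp: lt indicator_def)
        also have "\<dots> = ennreal (real ?t) * ennreal (I u)"
          by (cases "0 \<le> I u") (simp_all add: nn_integral_cmult_indicator ennreal_neg)
        finally show ?thesis by (simp add: ennreal_mult')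
      qed
      then show ?thesis
        unfolding lookahead_def layered_potential_def f_def distrib_right by (subst nn_integral_add) auto
    qed
    finally show ?thesis .
  qed
  have "(\<integral>\<^sup>+x. lookahead M n r m x (decide M n r m x) \<partial>M)
      = (\<integral>\<^sup>+x. lookahead M n r m x (decide M n r m x) \<partial>distr (restrict_space lborel {0<..<1}) borel I)"
    by (simp only: distr_I_eq_M)
  also have "\<dots> = (\<integral>\<^sup>+u. lookahead M n r m (I u) (decide M n r m (I u)) \<partial>restrict_space lborel {0<..<1})"
  proof (rule nn_integral_distr)
    have "(\<lambda>x. lookahead M n r m x (decide M n r m x)) \<in> borel_measurable borel"
      by (rule measurable_compose_countable[where g="decide M n r m"]) (auto simp: lookahead_def)
    then show "(\<lambda>x. lookahead M n r m x (decide M n r m x))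
        \<in> borel_measurable (distr (restrict_space lborel {0<..<1}) borel I)"
      by simp
    show "I \<in> borel_measurable (restrict_space lborel {0<..<1})"
      using measurable_CI by (simp cong: measurable_cong_sets sets_restrict_space_cong)
  qed
  also have "\<dots> = (\<integral>\<^sup>+u. lookahead M n r m (I u) (decide M n r m (I u)) * indicator {0<..<1} u \<partial>lborel)"
    by (simp add: nn_integral_restrict_space)
  also have "\<dots> \<le> (\<integral>\<^sup>+u. (\<integral>\<^sup>+s. f u s \<partial>lborel) * indicator {0<..<1} u \<partial>lborel)"
    by (intro nn_integral_mono) (auto simp: bound split: split_indicator)
  also have "\<dots> = (\<integral>\<^sup>+u. (\<integral>\<^sup>+s. f u s \<partial>lborel) \<partial>unif)"
    using meas by (subst nn_integral_unif) (auto intro!: lborel.borel_measurable_nn_integral)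
  also have "\<dots> = (\<integral>\<^sup>+s. (\<integral>\<^sup>+u. f u s \<partial>unif) \<partial>lborel)"
    by (rule Fubini'[symmetric]) (use meas in \<open>simp cong: measurable_cong_sets add: split_beta'\<close>)
  also have "\<dots> \<le> (\<integral>\<^sup>+s. potential n (cdf M s) r m * indicator {0..} s \<partial>lborel)"
  proof (intro nn_integral_mono)
    fix s :: real
    show "(\<integral>\<^sup>+u. f u s \<partial>unif) \<le> potential n (cdf M s) r m * indicator {0..} s"
      using potential_step[OF r m(2), of "cdf M s"] by (cases "0 \<le> s") (simp_all add: f_def)
  qed
  finally show ?thesis by (simp add: layered_potential_def)
qed

text \<open>Negative terms become 0 under \<open>ennreal\<close>, which can only enlarge the right
  side; this handles sample points with negative values.\<close>

lemma ennreal_sum_le: "finite A \<Longrightarrow> ennreal (\<Sum>i\<in>A. f i) \<le> (\<Sum>i\<in>A. ennreal (f i))"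
proof (induction A rule: finite_induct)
  case (insert a A)
  have "ennreal (f a + sum f A) \<le> ennreal (f a) + ennreal (sum f A)"
    by (cases "0 \<le> f a"; cases "0 \<le> sum f A") (auto simp: ennreal_neg intro!: ennreal_leI)
  also have "\<dots> \<le> ennreal (f a) + (\<Sum>i\<in>A. ennreal (f i))" using insert by (intro add_mono) auto
  finally show ?case using insert by simp
qed simp

text \<open>Supermartingale argument: the cost so far plus the potential of the current state does
  not increase in expectation. The newest coordinate is integrated first, by
  \<open>decide_step\<close>.\<close>

lemma greedy_prefix_le:
  assumes M: "distF M" and "k \<le> n"
  shows "(\<integral>\<^sup>+x. (\<Sum>i<k. ennreal (real (T greedy M n x i) * x i)) + layered_potential M n (covered M n x k) (n - k) \<partial>sample M k)
     \<le> layered_potential M n 0 n"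
  using assms(2)
proof (induction k)
  case 0
  interpret prob_space M using M by (simp add: distF_def)
  interpret product_sigma_finite "\<lambda>_::nat. M" ..
  show ?case by (simp add: sample_def PiM_empty nn_integral_count_space_finite)
next
  case (Suc k)
  interpret prob_space M using M by (simp add: distF_def)
  interpret product_sigma_finite "\<lambda>_::nat. M" ..
  have sM: "sets M = sets borel" using M by (simp add: distF_def)
  define S where "S x = (\<Sum>i<k. ennreal (real (T greedy M n x i) * x i))" for x
  let ?f = "\<lambda>x. (\<Sum>i<Suc k. ennreal (real (T greedy M n x i) * x i)) + layered_potential M n (covered M n x (Suc k)) (n - Suc k)"
  have meas: "?f \<in> borel_measurable (PiM {..<Suc k} (\<lambda>_. M))"
  proof -
    have "(\<lambda>x. x i) \<in> borel_measurable (PiM {..<Suc k} (\<lambda>_. M))" if "i < Suc k" for i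
      using measurable_component_singleton[of i "{..<Suc k}" "\<lambda>_. M"] that sM by (simp cong: measurable_cong_sets)
    moreover have "(\<lambda>x. real (T greedy M n x i)) \<in> borel_measurable (PiM {..<Suc k} (\<lambda>_. M))" if "i < Suc k" for i
      using measurable_greedy[OF sM that] by simp
    moreover have "(\<lambda>x. layered_potential M n (covered M n x (Suc k)) (n - Suc k)) \<in> borel_measurable (PiM {..<Suc k} (\<lambda>_. M))"
      using measurable_covered[OF sM, of "Suc k" "Suc k"] by measurable
    ultimately show ?thesis
      by (intro borel_measurable_add borel_measurable_sum measurable_compose[OF _ measurable_ennreal] borel_measurable_times) auto
  qed
  \<comment> \<open>The new coordinate changes neither earlier decisions nor the state before it, so
    it enters only through \<open>lookahead\<close>.\<close>
  have step: "?f (x(k := y)) = S x + lookahead M n (covered M n x k) (n - k) y (decide M n (covered M n x k) (n - k) y)" for x y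
  proof -
    have c: "covered M n (x(k := y)) i = covered M n x i" if "i \<le> k" for i
      using that by (intro covered_cong) auto
    have "(\<Sum>i<k. ennreal (real (T greedy M n (x(k := y)) i) * (x(k := y)) i)) = S x"
      unfolding S_def by (intro sum.cong) (auto simp: T_greedy c)
    then show ?thesis by (simp add: T_greedy c lookahead_def add.assoc)
  qed
  have "(\<integral>\<^sup>+x. ?f x \<partial>sample M (Suc k)) = (\<integral>\<^sup>+x. \<integral>\<^sup>+y. ?f (x(k := y)) \<partial>M \<partial>sample M k)"
    unfolding sample_def using meas unfolding lessThan_Suc
    by (intro product_nn_integral_insert) auto
  also have "\<dots> \<le> (\<integral>\<^sup>+x. S x + layered_potential M n (covered M n x k) (n - k) \<partial>sample M k)"
  proof (intro nn_integral_mono)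
    fix x
    let ?r = "covered M n x k"
    have "(\<lambda>y. lookahead M n ?r (n - k) y (decide M n ?r (n - k) y)) \<in> borel_measurable borel"
      by (rule measurable_compose_countable[where g="decide M n ?r (n - k)"]) (auto simp: lookahead_def)
    then have "(\<lambda>y. lookahead M n ?r (n - k) y (decide M n ?r (n - k) y)) \<in> borel_measurable M"
      using sM by (simp cong: measurable_cong_sets)
    then have "(\<integral>\<^sup>+y. ?f (x(k := y)) \<partial>M) = S x + (\<integral>\<^sup>+y. lookahead M n ?r (n - k) y (decide M n ?r (n - k) y) \<partial>M)"
      unfolding step by (simp add: nn_integral_add emeasure_space_1)
    also have "\<dots> \<le> S x + layered_potential M n ?r (n - k)"
      using decide_step[OF M, of "n - k" n ?r] Suc.prems by (intro add_left_mono) auto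
    finally show "(\<integral>\<^sup>+y. ?f (x(k := y)) \<partial>M) \<le> S x + layered_potential M n ?r (n - k)" .
  qed
  also have "\<dots> \<le> layered_potential M n 0 n" using Suc unfolding S_def by simp
  finally show ?case .
qed

lemma ALG_greedy_le:
  assumes "distF M"
  shows "ALG greedy M n \<le> layered_potential M n 0 n"
proof -
  have "ALG greedy M n \<le> (\<integral>\<^sup>+x. (\<Sum>i<n. ennreal (real (T greedy M n x i) * x i)) + layered_potential M n (covered M n x n) (n - n) \<partial>sample M n)"
    unfolding ALG_def by (intro nn_integral_mono add_increasing2 ennreal_sum_le) auto
  also have "\<dots> \<le> layered_potential M n 0 n" by (rule greedy_prefix_le[OF assms order_refl])
  finally show ?thesis .
qed

section \<open>The optimum by levels and the competitive ratio\<close>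

text \<open>Layer-cake formula again: by independence the minimum of the first \<open>Suc i\<close>
  costs exceeds \<open>s\<close> with probability \<open>(1 - cdf M s) ^ Suc i\<close>.\<close>

lemma OPT_ge:
  assumes M: "distF M"
  shows "(\<integral>\<^sup>+s. ennreal (\<Sum>i<n. (1 - cdf M s) ^ Suc i) * indicator {0..} s \<partial>lborel) \<le> OPT M n"
proof -
  interpret real_distribution M by (rule distF_real_distribution) fact
  interpret cdf_distribution M by standard
  interpret P: product_sigma_finite "\<lambda>_::nat. M" ..
  interpret PP: product_prob_space "\<lambda>_::nat. M" "{..<n}" ..
  have sM: "sets M = sets borel" using M by (simp add: distF_def)
  interpret S: prob_space "sample M n" unfolding sample_def by (rule PP.prob_space_axioms)
  interpret SL: pair_sigma_finite "sample M n" lborel ..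
  have comp [measurable]: "(\<lambda>x. x i) \<in> borel_measurable (sample M n)" if "i < n" for i
    using measurable_component_singleton[of i "{..<n}" "\<lambda>_. M"] that sM
    unfolding sample_def by (simp cong: measurable_cong_sets)
  \<comment> \<open>Off a null set all minima are nonnegative, so \<open>ennreal\<close> commutes
    with their sum.\<close>
  have pos: "AE x in sample M n. \<forall>i<n. 0 \<le> x i"
  proof -
    have "AE x in sample M n. 0 \<le> x i" if "i < n" for i
      unfolding sample_def using that M
      by (intro AE_PiM_component) (auto simp: distF_def prob_space_axioms)
    then show ?thesis by (subst AE_all_countable) auto
  qed
  have Min_ge: "s < Min (x ` {..i}) \<longleftrightarrow> (\<forall>j\<le>i. s < x j)" for s and x :: "nat \<Rightarrow> real" and i
    by (auto simp: Min_gr_iff)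
  have Min_meas [measurable]: "(\<lambda>x. Min (x ` {..i})) \<in> borel_measurable (sample M n)" if "i < n" for i
    using that by (intro borel_measurable_Min) auto
  have tail: "emeasure (sample M n) {x \<in> space (sample M n). s < Min (x ` {..i})} = ennreal ((1 - cdf M s) ^ Suc i)"
    if i: "i < n" for s i
  proof -
    have "{x \<in> space (sample M n). s < Min (x ` {..i})} = PiE {..<n} (\<lambda>j. if j \<le> i then {s<..} else space M)"
    proof (intro set_eqI iffI)
      fix x assume "x \<in> {x \<in> space (sample M n). s < Min (x ` {..i})}"
      then show "x \<in> PiE {..<n} (\<lambda>j. if j \<le> i then {s<..} else space M)"
        by (simp add: Min_ge sample_def space_PiM PiE_iff)
    next
      fix x assume x: "x \<in> PiE {..<n} (\<lambda>j. if j \<le> i then {s<..} else space M)"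
      have "s < x j" if "j \<le> i" for j
        using PiE_mem[OF x, of j] that i by simp
      then show "x \<in> {x \<in> space (sample M n). s < Min (x ` {..i})}"
        using x by (simp add: Min_ge sample_def space_PiM PiE_iff)
    qed
    then have "emeasure (sample M n) {x \<in> space (sample M n). s < Min (x ` {..i})}
        = (\<Prod>j<n. emeasure M (if j \<le> i then {s<..} else space M))"
      unfolding sample_def by (simp only:) (subst P.emeasure_PiM, auto)
    also have "\<dots> = (\<Prod>j<n. if j \<le> i then ennreal (1 - cdf M s) else 1)"
    proof -
      have "{s<..} = space M - {..s}" by auto
      then have "emeasure M {s<..} = ennreal (1 - cdf M s)"
        using prob_compl[of "{..s}"] by (simp add: emeasure_eq_measure cdf_def)
      then show ?thesis by (intro prod.cong) (auto simp: emeasure_space_1[simplified])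
    qed
    also have "\<dots> = ennreal (1 - cdf M s) ^ card ({..<n} \<inter> {j. j \<le> i})"
      by (subst prod.If_cases) auto
    also have "{..<n} \<inter> {j. j \<le> i} = {..i}" using i by auto
    finally show ?thesis using cdf_bounded_prob[of s] by (simp add: ennreal_power del: power_Suc)
  qed
  have single: "(\<integral>\<^sup>+s. ennreal ((1 - cdf M s) ^ Suc i) * indicator {0..} s \<partial>lborel)
      = (\<integral>\<^sup>+x. ennreal (Min (x ` {..i})) \<partial>sample M n)" if i: "i < n" for i
  proof -
    note [measurable] = Min_meas[OF i]
    have "(\<integral>\<^sup>+s. ennreal ((1 - cdf M s) ^ Suc i) * indicator {0..} s \<partial>lborel)
       = (\<integral>\<^sup>+s. \<integral>\<^sup>+x. of_bool (0 \<le> s \<and> s < Min (x ` {..i})) \<partial>sample M n \<partial>lborel)"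
    proof (intro nn_integral_cong)
      fix s :: real
      have "(\<integral>\<^sup>+x. of_bool (0 \<le> s \<and> s < Min (x ` {..i})) \<partial>sample M n)
        = (\<integral>\<^sup>+x. indicator {0..} s * indicator {x \<in> space (sample M n). s < Min (x ` {..i})} x \<partial>sample M n)"
        by (intro nn_integral_cong) (auto simp: indicator_def)
      also have "\<dots> = indicator {0..} s * ennreal ((1 - cdf M s) ^ Suc i)"
      proof (subst nn_integral_cmult_indicator)
        show "{x \<in> space (sample M n). s < Min (x ` {..i})} \<in> sets (sample M n)"
          by measurable
      qed (simp only: tail[OF i])
      finally show "ennreal ((1 - cdf M s) ^ Suc i) * indicator {0..} s
        = (\<integral>\<^sup>+x. of_bool (0 \<le> s \<and> s < Min (x ` {..i})) \<partial>sample M n)" by (simp add: mult.commute)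
    qed
    also have "\<dots> = (\<integral>\<^sup>+x. \<integral>\<^sup>+s. of_bool (0 \<le> s \<and> s < Min (x ` {..i})) \<partial>lborel \<partial>sample M n)"
      by (rule SL.Fubini') measurable
    also have "\<dots> = (\<integral>\<^sup>+x. ennreal (Min (x ` {..i})) \<partial>sample M n)"
    proof (intro nn_integral_cong)
      have "(\<integral>\<^sup>+s. of_bool (0 \<le> s \<and> s < y) \<partial>lborel) = ennreal y" for y :: real
      proof -
        have "(\<integral>\<^sup>+s. of_bool (0 \<le> s \<and> s < y) \<partial>lborel) = (\<integral>\<^sup>+s. indicator {0..<y} s \<partial>lborel)"
          by (intro nn_integral_cong) (auto simp: indicator_def)
        then show ?thesis by (cases "0 \<le> y") (simp_all add: ennreal_neg)
      qed
      then show "(\<integral>\<^sup>+s. of_bool (0 \<le> s \<and> s < Min (x ` {..i})) \<partial>lborel) = ennreal (Min (x ` {..i}))" for x :: "nat \<Rightarrow> real" .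
    qed
    finally show ?thesis .
  qed
  have "(\<integral>\<^sup>+s. ennreal (\<Sum>i<n. (1 - cdf M s) ^ Suc i) * indicator {0..} s \<partial>lborel)
      = (\<integral>\<^sup>+s. (\<Sum>i<n. ennreal ((1 - cdf M s) ^ Suc i) * indicator {0..} s) \<partial>lborel)"
  proof (intro nn_integral_cong)
    fix s
    have "ennreal (\<Sum>i<n. (1 - cdf M s) ^ Suc i) = (\<Sum>i<n. ennreal ((1 - cdf M s) ^ Suc i))"
      using cdf_bounded_prob[of s] by (intro sum_ennreal[symmetric] zero_le_power) simp
    then show "ennreal (\<Sum>i<n. (1 - cdf M s) ^ Suc i) * indicator {0..} s
        = (\<Sum>i<n. ennreal ((1 - cdf M s) ^ Suc i) * indicator {0..} s)"
      by (simp only: sum_distrib_right)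
  qed
  also have "\<dots> = (\<Sum>i<n. (\<integral>\<^sup>+s. ennreal ((1 - cdf M s) ^ Suc i) * indicator {0..} s \<partial>lborel))"
    by (rule nn_integral_sum) simp
  also have "\<dots> = (\<Sum>i<n. (\<integral>\<^sup>+x. ennreal (Min (x ` {..i})) \<partial>sample M n))"
    by (intro sum.cong) (simp_all add: single del: power_Suc)
  also have "\<dots> = (\<integral>\<^sup>+x. (\<Sum>i<n. ennreal (Min (x ` {..i}))) \<partial>sample M n)"
    by (rule nn_integral_sum[symmetric]) simp
  also have "\<dots> = OPT M n"
    unfolding OPT_def
  proof (intro nn_integral_cong_AE, use pos in eventually_elim)
    fix x :: "nat \<Rightarrow> real"
    assume "\<forall>i<n. 0 \<le> x i"
    then show "(\<Sum>i<n. ennreal (Min (x ` {..i}))) = ennreal (\<Sum>i<n. Min (x ` {..i}))"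
      by (intro sum_ennreal) auto
  qed
  finally show ?thesis by simp
qed

text \<open>Both costs are compared as integrals over the levels \<open>s \<ge> 0\<close>, so the
  bound at the single quantile \<open>cdf M s\<close> suffices.\<close>

lemma RC_greedy_le:
  assumes n: "20 \<le> n"
  shows "RC greedy n \<le> ennreal 4.179"
  unfolding RC_def
proof (intro SUP_least)
  fix M assume "M \<in> {M. distF M}"
  then have M: "distF M" by simp
  interpret real_distribution M by (rule distF_real_distribution) fact
  interpret cdf_distribution M by standard
  have "ALG greedy M n \<le> layered_potential M n 0 n" by (rule ALG_greedy_le[OF M])
  also have "\<dots> \<le> (\<integral>\<^sup>+s. ennreal 4.179 * (ennreal (\<Sum>i<n. (1 - cdf M s) ^ Suc i) * indicator {0..} s) \<partial>lborel)"
    unfolding layered_potential_def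
  proof (intro nn_integral_mono)
    fix s
    show "potential n (cdf M s) 0 n * indicator {0..} s \<le> ennreal 4.179 * (ennreal (\<Sum>i<n. (1 - cdf M s) ^ Suc i) * indicator {0..} s)"
    proof (cases "0 \<le> s")
      case True
      have "0 \<le> (\<Sum>i<n. (1 - cdf M s) ^ Suc i)"
        using cdf_bounded_prob[of s] by (intro sum_nonneg zero_le_power) simp
      then have "ennreal (4.179 * (\<Sum>i<n. (1 - cdf M s) ^ Suc i)) = ennreal 4.179 * ennreal (\<Sum>i<n. (1 - cdf M s) ^ Suc i)"
        by (intro ennreal_mult) auto
      then show ?thesis
        using potential_0_le[OF n cdf_nonneg cdf_bounded_prob, of s] True
        by (simp only: indicator_simps mult_1_right atLeast_iff)
    qed simp
  qed
  also have "\<dots> = ennreal 4.179 * (\<integral>\<^sup>+s. ennreal (\<Sum>i<n. (1 - cdf M s) ^ Suc i) * indicator {0..} s \<partial>lborel)"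
    by (rule nn_integral_cmult) simp
  also have "\<dots> \<le> ennreal 4.179 * OPT M n" by (intro mult_left_mono OPT_ge M) simp
  finally have le: "ALG greedy M n \<le> ennreal 4.179 * OPT M n" .
  show "ALG greedy M n / OPT M n \<le> ennreal 4.179"
  proof (cases "OPT M n = 0 \<or> OPT M n = \<top>")
    \<comment> \<open>If \<open>OPT M n\<close> is 0, so is the algorithm's cost, and
      \<open>0 / 0 = 0\<close>; division by infinity gives 0.\<close>
    case True
    then show ?thesis using le by (auto simp: ennreal_divide_top)
  next
    case False
    have "ALG greedy M n / OPT M n \<le> ennreal 4.179 * OPT M n / OPT M n"
      by (intro divide_right_mono_ennreal le)
    also have "\<dots> = ennreal 4.179" using False by (simp add: ennreal_mult_divide_eq)
    finally show ?thesis .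
  qed
qed

theorem mainTheorem11:
  shows "\<exists>A. valid_alg A \<and> limsup (\<lambda>n. RC A n) \<le> ennreal (4.179::real)"
proof (intro exI conjI)
  show "valid_alg greedy" by (rule valid_greedy)
  show "limsup (\<lambda>n. RC greedy n) \<le> ennreal (4.179::real)"
    by (intro Limsup_bounded eventually_sequentiallyI[of 20] RC_greedy_le)
qed

end
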